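(* Suppose that $A,B\in C^2(\mathbb R)$ and that $u:\mathbb R^2\to\mathbb R$ is a $C^2$ entire solution of the problem $$(L_u)^2u=0\ \text{ in }\mathbb R^2,\qquad u(x,0)=B(x),\qquad (L_uu)(x,0)=A(x)\qquad(x\in\mathbb R).$$ For $c,t\in\mathbb R$ set $x(c,t):=\frac{A(c)}2t^2+B(c)t+c$, $F(c,t):=(x(c,t),t)$, $\Omega:=F(\mathbb R^2)$, and for $(x,t)\in\Omega$ let $c(x,t)$ be defined by $F^{-1}(x,t)=(c(x,t),t)$. Then $$u(x,t)=A(c(x,t))\,t+B(c(x,t))\qquad\text{for all }(x,t)\in\Omega,$$ and $u$ is the unique ($C^2$) solution in $\Omega$ of the same problem.
   Context: For a function $u$ of class $C^1$ of the variables $(x,t)$, $L_u$ is the operator $L_uv:=v_t+u\,v_x$, and $(L_u)^2u:=L_u(L_uu)$. Under the stated hypotheses $F$ is injective and $\Omega$ is an open set containing the $x$-axis, so that $c(x,t)$ is well defined. "The same problem" in $\Omega$ means: $(L_w)^2w=0$ in $\Omega$, $w(x,0)=B(x)$ and $(L_ww)(x,0)=A(x)$ for all $x\in\mathbb R$, with $w\in C^2(\Omega)$. *)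

theory Defs
  imports "HOL-Analysis.Analysis"
begin

definition partial :: "'a::euclidean_space \<Rightarrow> ('a \<Rightarrow> real) \<Rightarrow> 'a \<Rightarrow> real" where
  "partial b f p = deriv (\<lambda>s. f (p + s *\<^sub>R b)) 0"

(* The class C^k on an open set S: all partial derivatives (along the standard basis) of order
   at most k exist and are continuous on S.  Only the values of f on S matter when S is open. *)
primrec Ck_on :: "nat \<Rightarrow> 'a::euclidean_space set \<Rightarrow> ('a \<Rightarrow> real) \<Rightarrow> bool" where
  "Ck_on 0 S f \<longleftrightarrow> continuous_on S f"
| "Ck_on (Suc k) S f \<longleftrightarrow>
     continuous_on S f \<and>
     (\<forall>b\<in>Basis.
        (\<forall>p\<in>S. (\<lambda>s::real. f (p + s *\<^sub>R b)) field_differentiable (at 0)) \<and>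
        Ck_on k S (partial b f))"

(* Points of the plane are pairs (x, t), so (1,0) is the x-direction and (0,1) the
   t-direction:  L u v = v_t + u v_x. *)
definition L :: "(real \<times> real \<Rightarrow> real) \<Rightarrow> (real \<times> real \<Rightarrow> real) \<Rightarrow> real \<times> real \<Rightarrow> real" where
  "L u v p = partial (0, 1) v p + u p * partial (1, 0) v p"

(* Functions are total in HOL; a solution in D is constrained only on D, which is meant to be an
   open set containing the x-axis. *)
definition C2_solution_in ::
    "(real \<times> real) set \<Rightarrow> (real \<Rightarrow> real) \<Rightarrow> (real \<Rightarrow> real) \<Rightarrow> (real \<times> real \<Rightarrow> real) \<Rightarrow> bool" where
  "C2_solution_in D A B u \<longleftrightarrow>
     Ck_on 2 D u \<and>
     (\<forall>p\<in>D. L u (L u u) p = 0) \<and>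
     (\<forall>x. u (x, 0) = B x) \<and>
     (\<forall>x. L u u (x, 0) = A x)"

definition char_map :: "(real \<Rightarrow> real) \<Rightarrow> (real \<Rightarrow> real) \<Rightarrow> real \<times> real \<Rightarrow> real \<times> real" where
  "char_map A B = (\<lambda>(c, t). (A c / 2 * t\<^sup>2 + B c * t + c, t))"

definition char_dom :: "(real \<Rightarrow> real) \<Rightarrow> (real \<Rightarrow> real) \<Rightarrow> (real \<times> real) set" where
  "char_dom A B = range (char_map A B)"

(* The function c(x,t): meaningful when char_map A B is injective and (x,t) lies in its range;
   the second component of the inverse image is then t. *)
definition char_foot :: "(real \<Rightarrow> real) \<Rightarrow> (real \<Rightarrow> real) \<Rightarrow> real \<times> real \<Rightarrow> real" where
  "char_foot A B p = fst (inv (char_map A B) p)"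

end

theory Submission
  imports Defs
begin

text \<open>
  Along the parabola \<open>s \<mapsto> F(c, s)\<close> a solution \<open>w\<close> satisfies \<open>w = A(c) s + B(c)\<close> and
  \<open>L\<^sub>w w = A(c)\<close>: since the parabola is given in advance, the deviations \<open>g\<close> and \<open>v\<close> of these two
  quantities obey the linear system \<open>g' = v - g w\<^sub>x\<close>, \<open>v' = - g (L\<^sub>w w)\<^sub>x\<close> with zero initial data,
  so they vanish by Gronwall and no existence theorem for characteristics is needed.
  For \<open>u\<close>, the pair \<open>(u, L\<^sub>u u)\<close> at \<open>F(c, t)\<close> then determines \<open>A(c)\<close> and \<open>B(c)\<close>, hence \<open>c\<close>, so
  \<open>F\<close> is injective; \<open>\<Omega>\<close> is open by invariance of domain. For other solutions in \<open>\<Omega>\<close> uniqueness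
  holds because the parabolas cover \<open>\<Omega>\<close>.
\<close>

section \<open>A Gronwall lemma in both time directions\<close>

lemma gronwall_zero:
  fixes E E' k :: "real \<Rightarrow> real"
  assumes deriv: "\<And>s. (E has_real_derivative E' s) (at s)"
    and bound: "\<And>s. \<bar>E' s\<bar> \<le> k s * E s"
    and nonneg: "\<And>s. 0 \<le> E s"
    and k: "continuous_on UNIV k"
    and "E 0 = 0"
  shows "E t = 0"
proof -
  \<comment> \<open>\<open>k\<close> may be unbounded on the line; compactness supplies a constant
    \<open>K\<close> between \<open>0\<close> and \<open>t\<close>.\<close>
  have "compact (k ` {- \<bar>t\<bar>..\<bar>t\<bar>})"
    using k continuous_on_subset by (intro compact_continuous_image) auto
  then obtain K where K: "\<And>s. \<bar>s\<bar> \<le> \<bar>t\<bar> \<Longrightarrow> k s \<le> K"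
    by (fastforce dest: compact_imp_bounded bounded_imp_bdd_above simp: bdd_above_def abs_le_iff)
  have E': "\<bar>E' s\<bar> \<le> K * E s" if "\<bar>s\<bar> \<le> \<bar>t\<bar>" for s
    using bound[of s] mult_right_mono[OF K[OF that] nonneg[of s]] by linarith
  have "E t \<le> 0"
  proof (cases "0 \<le> t")
    case True
    \<comment> \<open>Forward in time the integrating factor \<open>exp (- K * s)\<close> absorbs
      the upper bound \<open>E' s \<le> K * E s\<close>.\<close>
    have "E t * exp (- K * t) \<le> E 0 * exp (- K * 0)"
    proof (rule DERIV_nonpos_imp_nonincreasing[OF True])
      fix s assume s: "0 \<le> s" "s \<le> t"
      have "((\<lambda>s. E s * exp (- K * s)) has_real_derivative (E' s - K * E s) * exp (- K * s)) (at s)"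
        by (auto intro!: derivative_eq_intros deriv simp: algebra_simps)
      moreover have "(E' s - K * E s) * exp (- K * s) \<le> 0"
        using E'[of s] s by (intro mult_nonpos_nonneg) auto
      ultimately show "\<exists>y. ((\<lambda>s. E s * exp (- K * s)) has_real_derivative y) (at s) \<and> y \<le> 0"
        by blast
    qed
    then show ?thesis
      using \<open>E 0 = 0\<close> by (simp add: mult_le_0_iff)
  next
    case False
    \<comment> \<open>Backward in time the lower bound \<open>- K * E s \<le> E' s\<close> is used,
      so the exponent changes sign.\<close>
    have "E t * exp (K * t) \<le> E 0 * exp (K * 0)"
    proof (rule DERIV_nonneg_imp_nondecreasing[of t 0])
      show "t \<le> 0" using False by simp
    next
      fix s assume s: "t \<le> s" "s \<le> 0"
      have "((\<lambda>s. E s * exp (K * s)) has_real_derivative (E' s + K * E s) * exp (K * s)) (at s)"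
        by (auto intro!: derivative_eq_intros deriv simp: algebra_simps)
      moreover have "0 \<le> (E' s + K * E s) * exp (K * s)"
        using E'[of s] s by (intro mult_nonneg_nonneg) auto
      ultimately show "\<exists>y. ((\<lambda>s. E s * exp (K * s)) has_real_derivative y) (at s) \<and> 0 \<le> y"
        by blast
    qed
    then show ?thesis
      using \<open>E 0 = 0\<close> by (simp add: mult_le_0_iff)
  qed
  with nonneg[of t] show ?thesis by linarith
qed

section \<open>Calculus of C^1 functions: sums and products, total derivative, chain rule\<close>

lemma Ck_on_subset: "Ck_on k S f \<Longrightarrow> T \<subseteq> S \<Longrightarrow> Ck_on k T f"
  by (induction k arbitrary: f) (auto intro: continuous_on_subset)

lemma Ck_on_1_DERIV:
  assumes "Ck_on 1 S f" "b \<in> Basis" "p \<in> S"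
  shows "((\<lambda>s. f (p + s *\<^sub>R b)) has_real_derivative partial b f p) (at 0)"
  using assms by (simp add: partial_def DERIV_deriv_iff_field_differentiable)

text \<open>Candidate derivatives \<open>f' b\<close> agree with \<open>partial b f\<close> on
  \<open>S\<close>, so their continuity on \<open>S\<close> carries over.\<close>

lemma Ck_on_1I:
  assumes "continuous_on S f"
    and "\<And>b p. b \<in> Basis \<Longrightarrow> p \<in> S \<Longrightarrow>
      ((\<lambda>s. f (p + s *\<^sub>R b)) has_real_derivative f' b p) (at 0)"
    and "\<And>b. b \<in> Basis \<Longrightarrow> continuous_on S (f' b)"
  shows "Ck_on 1 S f"
proof -
  have "partial b f p = f' b p" if "b \<in> Basis" "p \<in> S" for b p
    unfolding partial_def using assms(2)[OF that] by (rule DERIV_imp_deriv)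
  then have "continuous_on S (partial b f)" if "b \<in> Basis" for b
    using assms(3)[OF that] that by (simp cong: continuous_on_cong)
  with assms show ?thesis
    by (auto simp: field_differentiable_def)
qed

lemma Ck_on_1_add:
  assumes f: "Ck_on 1 S f" and g: "Ck_on 1 S g"
  shows "Ck_on 1 S (\<lambda>p. f p + g p)"
proof (rule Ck_on_1I)
  show "((\<lambda>s. f (p + s *\<^sub>R b) + g (p + s *\<^sub>R b)) has_real_derivative
      partial b f p + partial b g p) (at 0)" if "b \<in> Basis" "p \<in> S" for b p
    using Ck_on_1_DERIV[OF f that] Ck_on_1_DERIV[OF g that] by (rule DERIV_add)
qed (use f g in \<open>auto intro!: continuous_intros\<close>)

lemma Ck_on_1_mult:
  assumes f: "Ck_on 1 S f" and g: "Ck_on 1 S g"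
  shows "Ck_on 1 S (\<lambda>p. f p * g p)"
proof (rule Ck_on_1I)
  show "((\<lambda>s. f (p + s *\<^sub>R b) * g (p + s *\<^sub>R b)) has_real_derivative
      f p * partial b g p + g p * partial b f p) (at 0)" if "b \<in> Basis" "p \<in> S" for b p
    using DERIV_mult[OF Ck_on_1_DERIV[OF f that] Ck_on_1_DERIV[OF g that]]
    by (simp add: algebra_simps)
qed (use f g in \<open>auto intro!: continuous_intros\<close>)

text \<open>Continuous partial derivatives give Frechet differentiability, which the chain rule
  along curves requires.\<close>

lemma Ck_on_1_has_derivative:
  fixes f :: "real \<times> real \<Rightarrow> real"
  assumes f: "Ck_on 1 S f" and "open S" "p \<in> S"
  shows "(f has_derivative (\<lambda>(h, k). partial (1, 0) f p * h + partial (0, 1) f p * k)) (at p)"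
proof -
  obtain x y where p: "p = (x, y)" by fastforce
  obtain U V where UV: "open U" "open V" "x \<in> U" "y \<in> V" "U \<times> V \<subseteq> S"
    using open_prod_elim[OF \<open>open S\<close> \<open>p \<in> S\<close>] p by (metis mem_Sigma_iff)
  \<comment> \<open>\<open>has_derivative_partialsI\<close> works on a product whose second factor
    is convex, hence a ball inside \<open>V\<close>.\<close>
  obtain e where e: "0 < e" "ball y e \<subseteq> V"
    using UV by (meson open_contains_ball)
  define Y where "Y = ball y e"
  have Y: "open Y" "convex Y" "y \<in> Y" "U \<times> Y \<subseteq> S"
    using UV e by (auto simp: Y_def)
  \<comment> \<open>\<open>partial\<close> differentiates a shifted function at \<open>0\<close>;
    \<open>DERIV_shift\<close> moves the base point back to the coordinate itself.\<close>
  have dx: "((\<lambda>x. f (x, y)) has_real_derivative partial (1, 0) f (x, y)) (at x)"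
    using Ck_on_1_DERIV[OF f _ \<open>p \<in> S\<close>, of "(1, 0)"] DERIV_shift[of "\<lambda>x. f (x, y)" _ 0 x]
    by (simp add: p Basis_prod_def add.commute)
  have dy: "((\<lambda>y. f (x, y)) has_real_derivative partial (0, 1) f (x, y)) (at y)"
    if "(x, y) \<in> S" for x y
    using Ck_on_1_DERIV[OF f _ that, of "(0, 1)"] DERIV_shift[of "\<lambda>y. f (x, y)" _ 0 y]
    by (simp add: Basis_prod_def add.commute)
  have "((\<lambda>(x, y). f (x, y)) has_derivative (\<lambda>(h, k). partial (1, 0) f (x, y) * h +
      blinfun_mult_right (partial (0, 1) f (x, y)) k)) (at (x, y) within U \<times> Y)"
  proof (rule has_derivative_partialsI)
    show "((\<lambda>x. f (x, y)) has_derivative (*) (partial (1, 0) f (x, y))) (at x within U)"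
      using dx by (simp add: has_field_derivative_def has_derivative_at_withinI)
    show "((\<lambda>y. f (x, y)) has_derivative blinfun_mult_right (partial (0, 1) f (x, y)))
        (at y within Y)" if "x \<in> U" "y \<in> Y" for x y
      using dy[of x y] Y that
      by (auto simp: has_field_derivative_def has_derivative_at_withinI)
    have "continuous_on (U \<times> Y) (partial (0, 1) f)"
      using f Y by (auto simp: Basis_prod_def intro: continuous_on_subset)
    then have "continuous (at (x, y) within U \<times> Y) (partial (0, 1) f)"
      using UV Y by (auto simp: continuous_on_eq_continuous_within)
    then show "continuous (at (x, y) within U \<times> Y)
        (\<lambda>(x, y). blinfun_mult_right (partial (0, 1) f (x, y)))"
      unfolding case_prod_unfold prod.collapse
      by (rule bounded_linear.continuous[OF bounded_linear_blinfun_mult_right])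
  qed (use Y in auto)
  moreover have "at (x, y) within U \<times> Y = at (x, y)"
    using UV Y by (intro at_within_open open_Times) auto
  ultimately show ?thesis
    by (simp add: p case_prod_unfold)
qed

text \<open>The slope \<open>a\<close> is independent of any solution; where it equals the value of
  \<open>w\<close>, the right-hand side is \<open>L w f\<close>.\<close>

lemma Ck_on_1_DERIV_graph:
  fixes f :: "real \<times> real \<Rightarrow> real"
  assumes f: "Ck_on 1 S f" and "open S" "(\<xi> s, s) \<in> S"
    and \<xi>: "(\<xi> has_real_derivative a) (at s)"
  shows "((\<lambda>s. f (\<xi> s, s)) has_real_derivative
    partial (0, 1) f (\<xi> s, s) + a * partial (1, 0) f (\<xi> s, s)) (at s)"
proof -
  have "((\<lambda>s. (\<xi> s, s)) has_derivative (\<lambda>h. (a * h, h))) (at s)"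
    using \<xi> by (auto intro!: derivative_eq_intros simp: has_field_derivative_def)
  from has_derivative_compose[OF this Ck_on_1_has_derivative[OF f \<open>open S\<close> \<open>(\<xi> s, s) \<in> S\<close>]]
  show ?thesis
    unfolding has_field_derivative_def
    by (rule has_derivative_eq_rhs) (simp add: fun_eq_iff algebra_simps)
qed

lemma Ck_on_1_L:
  assumes "Ck_on 2 S u"
  shows "Ck_on 1 S u" "Ck_on 1 S (L u u)"
proof -
  have D: "Ck_on 1 S (partial (1, 0) u)" "Ck_on 1 S (partial (0, 1) u)"
    using assms by (auto simp: numeral_2_eq_2 Basis_prod_def)
  show u: "Ck_on 1 S u"
    using assms by (auto simp: numeral_2_eq_2)
  show "Ck_on 1 S (L u u)"
    unfolding L_def using D u by (intro Ck_on_1_add Ck_on_1_mult)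
qed

section \<open>Solutions along the characteristic parabolas\<close>

text \<open>The set \<open>D\<close> is kept general so that the result serves both for
  \<open>u\<close> on the whole plane and for a competing solution on
  \<open>char_dom A B\<close>.\<close>

lemma solution_along_characteristic:
  assumes w: "C2_solution_in D A B w" and D: "open D" "\<And>s. char_map A B (c, s) \<in> D"
  shows "w (char_map A B (c, t)) = A c * t + B c" "L w w (char_map A B (c, t)) = A c"
proof -
  define \<xi> where "\<xi> s = A c / 2 * s\<^sup>2 + B c * s + c" for s
  have F: "char_map A B (c, s) = (\<xi> s, s)" for s
    by (simp add: char_map_def \<xi>_def)
  have mem: "(\<xi> s, s) \<in> D" for s
    using D F by metis
  have \<xi>: "(\<xi> has_real_derivative A c * s + B c) (at s)" for s
    unfolding \<xi>_def by (auto intro!: derivative_eq_intros)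
  have C1: "Ck_on 1 D w" "Ck_on 1 D (L w w)"
    using w Ck_on_1_L unfolding C2_solution_in_def by blast+
  define p where "p s = partial (1, 0) w (\<xi> s, s)" for s
  define q where "q s = partial (1, 0) (L w w) (\<xi> s, s)" for s
  have "continuous_on UNIV (\<lambda>s. (\<xi> s, s))"
    unfolding \<xi>_def by (intro continuous_intros)
  then have cont: "continuous_on UNIV p" "continuous_on UNIV q"
    using C1 mem unfolding p_def q_def
    by (auto simp: Basis_prod_def intro!: continuous_on_compose2[of D])
  define g where "g s = w (\<xi> s, s) - (A c * s + B c)" for s
  define v where "v s = L w w (\<xi> s, s) - A c" for s
  \<comment> \<open>The slope of the parabola is \<open>w - g\<close>, so the derivative of
    \<open>w\<close> along it is \<open>L w w - g * p\<close>.\<close>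
  have g: "(g has_real_derivative v s - g s * p s) (at s)" for s
    unfolding g_def using Ck_on_1_DERIV_graph[OF C1(1) D(1) mem \<xi>, of s]
    by (auto intro!: derivative_eq_intros simp: v_def p_def L_def algebra_simps)
  have "L w (L w w) (\<xi> s, s) = 0" for s
    using w mem by (auto simp: C2_solution_in_def)
  then have Lw: "partial (0, 1) (L w w) (\<xi> s, s) = - w (\<xi> s, s) * q s" for s
    by (simp add: L_def[of _ "L w w"] q_def add_eq_0_iff2)
  \<comment> \<open>In the same way the derivative of \<open>L w w\<close> is
    \<open>L w (L w w) - g * q\<close>, whose first term vanishes.\<close>
  have v: "(v has_real_derivative - (g s * q s)) (at s)" for s
    unfolding v_def using Ck_on_1_DERIV_graph[OF C1(2) D(1) mem \<xi>, of s] Lw[of s]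
    by (auto intro!: derivative_eq_intros simp: g_def q_def[symmetric] algebra_simps)
  \<comment> \<open>The energy has derivative \<open>2 g v - 2 p g\<^sup>2 - 2 q g v\<close>; with
    \<open>2 \<bar>g v\<bar> \<le> g\<^sup>2 + v\<^sup>2\<close> the three terms contribute
    \<open>1\<close>, \<open>2 \<bar>p\<bar>\<close> and \<open>\<bar>q\<bar>\<close> to the rate
    \<open>k\<close>.\<close>
  have "(g t)\<^sup>2 + (v t)\<^sup>2 = 0"
  proof (rule gronwall_zero[where E = "\<lambda>s. (g s)\<^sup>2 + (v s)\<^sup>2" and
        E' = "\<lambda>s. 2 * g s * (v s - g s * p s) - 2 * v s * (g s * q s)" and
        k = "\<lambda>s. 1 + 2 * \<bar>p s\<bar> + \<bar>q s\<bar>"])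
    fix s
    let ?E' = "2 * g s * (v s - g s * p s) - 2 * v s * (g s * q s)"
    show "((\<lambda>s. (g s)\<^sup>2 + (v s)\<^sup>2) has_real_derivative ?E') (at s)"
      by (auto intro!: derivative_eq_intros g v simp: algebra_simps)
    have gv: "2 * \<bar>g s * v s\<bar> \<le> (g s)\<^sup>2 + (v s)\<^sup>2"
      using sum_squares_bound[of "\<bar>g s\<bar>" "\<bar>v s\<bar>"] by (simp add: abs_mult)
    have "\<bar>?E'\<bar> \<le> 2 * \<bar>g s * v s\<bar> + 2 * \<bar>p s\<bar> * (g s)\<^sup>2 + \<bar>q s\<bar> * (2 * \<bar>g s * v s\<bar>)"
    proof -
      have "?E' = 2 * (g s * v s) - 2 * p s * (g s)\<^sup>2 - q s * (2 * (g s * v s))"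
        by (simp add: algebra_simps power2_eq_square)
      also have "\<bar>\<dots>\<bar> \<le> \<bar>2 * (g s * v s)\<bar> + \<bar>2 * p s * (g s)\<^sup>2\<bar> + \<bar>q s * (2 * (g s * v s))\<bar>"
        by linarith
      finally show ?thesis
        by (simp add: abs_mult)
    qed
    also have "\<dots> \<le> ((g s)\<^sup>2 + (v s)\<^sup>2) + 2 * \<bar>p s\<bar> * ((g s)\<^sup>2 + (v s)\<^sup>2)
        + \<bar>q s\<bar> * ((g s)\<^sup>2 + (v s)\<^sup>2)"
      using gv by (intro add_mono mult_left_mono) auto
    finally show "\<bar>?E'\<bar> \<le> (1 + 2 * \<bar>p s\<bar> + \<bar>q s\<bar>) * ((g s)\<^sup>2 + (v s)\<^sup>2)"
      by (simp add: algebra_simps)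
  next
    show "(g 0)\<^sup>2 + (v 0)\<^sup>2 = 0"
      using w by (simp add: g_def v_def \<xi>_def C2_solution_in_def)
  qed (use cont in \<open>auto intro!: continuous_intros\<close>)
  then have "g t = 0" "v t = 0"
    by (auto simp: sum_power2_eq_zero_iff)
  then show "w (char_map A B (c, t)) = A c * t + B c" "L w w (char_map A B (c, t)) = A c"
    by (simp_all add: F g_def v_def)
qed

section \<open>Injectivity, openness, the formula and uniqueness\<close>

theorem corollary4p12:
  fixes A B :: "real \<Rightarrow> real" and u :: "real \<times> real \<Rightarrow> real"
  assumes "Ck_on 2 UNIV A" and "Ck_on 2 UNIV B"
    and "C2_solution_in UNIV A B u"
  shows "inj (char_map A B) \<and> open (char_dom A B) \<and> (\<forall>x. (x, 0) \<in> char_dom A B) \<and>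
    (\<forall>x t. (x, t) \<in> char_dom A B \<longrightarrow>
       u (x, t) = A (char_foot A B (x, t)) * t + B (char_foot A B (x, t))) \<and>
    C2_solution_in (char_dom A B) A B u \<and>
    (\<forall>w. C2_solution_in (char_dom A B) A B w \<longrightarrow> (\<forall>p\<in>char_dom A B. w p = u p))"
proof -
  let ?F = "char_map A B" and ?\<Omega> = "char_dom A B"
  note u = solution_along_characteristic[OF assms(3) open_UNIV UNIV_I]
  have inj: "inj ?F"
  proof (rule injI, clarify)
    fix c s d t assume eq: "?F (c, s) = ?F (d, t)"
    then have "s = t"
      by (simp add: char_map_def)
    \<comment> \<open>At the common point \<open>L u u\<close> gives equality of the
      \<open>A\<close> values; then \<open>u\<close>, at equal times, gives that of the
      \<open>B\<close> values. In the first components of \<open>eq\<close> only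
      \<open>c = d\<close> remains.\<close>
    moreover from this have "A c = A d" "B c = B d"
      using u[of c s] u[of d t] eq by auto
    ultimately show "c = d \<and> s = t"
      using eq by (simp add: char_map_def)
  qed
  have "continuous_on UNIV A" "continuous_on UNIV B"
    using assms(1,2) by (simp_all add: numeral_2_eq_2)
  then have "continuous_on UNIV (\<lambda>p :: real \<times> real. A (fst p))"
    "continuous_on UNIV (\<lambda>p :: real \<times> real. B (fst p))"
    by (auto elim!: continuous_on_compose2 intro: continuous_on_fst continuous_on_id)
  then have "continuous_on UNIV ?F"
    unfolding char_map_def case_prod_unfold by (intro continuous_intros) auto
  \<comment> \<open>Invariance of domain turns continuity and injectivity into openness, without a
    Jacobian.\<close>
  then have "open ?\<Omega>"
    unfolding char_dom_def using inj by (intro invariance_of_domain) auto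
  moreover have "(x, 0) \<in> ?\<Omega>" for x
    unfolding char_dom_def by (rule range_eqI[of _ _ "(x, 0)"]) (simp add: char_map_def)
  moreover have "u (x, t) = A (char_foot A B (x, t)) * t + B (char_foot A B (x, t))"
    if xt: "(x, t) \<in> ?\<Omega>" for x t
  proof -
    obtain c s where "(x, t) = ?F (c, s)"
      using xt unfolding char_dom_def by fast
    then have c: "(x, t) = ?F (c, t)"
      by (simp add: char_map_def)
    then have "char_foot A B (x, t) = c"
      by (simp add: char_foot_def inv_f_f[OF inj])
    with u(1)[of c t] show ?thesis
      by (simp only: c)
  qed
  \<comment> \<open>\<open>partial\<close> and \<open>L\<close> refer to the total function, so
    their values at points of \<open>?\<Omega>\<close> are unchanged by restriction.\<close>
  moreover have "C2_solution_in ?\<Omega> A B u"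
    using assms(3) by (auto simp: C2_solution_in_def intro: Ck_on_subset)
  moreover have "w p = u p" if w: "C2_solution_in ?\<Omega> A B w" and "p \<in> ?\<Omega>" for w p
  proof -
    obtain c t where p: "p = ?F (c, t)"
      using \<open>p \<in> ?\<Omega>\<close> unfolding char_dom_def by fast
    show ?thesis
      \<comment> \<open>Each whole parabola lies in the range of \<open>?F\<close>, so the formula
        along it applies to \<open>w\<close> with \<open>D = ?\<Omega>\<close>.\<close>
      unfolding p u(1)
      by (rule solution_along_characteristic(1)[OF w \<open>open ?\<Omega>\<close>]) (simp add: char_dom_def)
  qed
  ultimately show ?thesis
    using inj by blast
qed

end
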